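(* Let $A\in\mathbb{R}^{n\times n}$ and consider a $(k+p)$-step randomized Arnoldi factorization $AV=VH_{k+p}+r_{k+p}e_{k+p}^T$ with wanted Ritz values $\tilde\lambda_1,\dots,\tilde\lambda_k$ and associated Ritz vectors $\tilde u_1,\dots,\tilde u_k$. Let $\tilde\lambda_{k+1},\dots,\tilde\lambda_{k+p}$ be the unwanted Ritz values. Apply $p$ shifted QR steps to $H_{k+p}$ with the exact shifts $\mu_i=\tilde\lambda_{k+i}$, $i=1,\dots,p$, giving the accumulated matrix $Q=Q^1Q^2\cdots Q^p$, and truncate, that is, keep $Q_1=Q[e_1,\dots,e_k]$ (the first $k$ columns of $Q$). Then the new Krylov basis $VQ_1$, which has $n$ rows and $k$ columns, satisfies $$\mathrm{span}\{VQ_1\}=\mathrm{span}\{\tilde u_1,\dots,\tilde u_k\}.$$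
   Context: All inner products and norms are Euclidean, and $\mathrm{span}\{M\}$ of a matrix $M$ is its column space. For $\Omega\in\mathbb{R}^{d\times n}$: $\Omega$ is an $\epsilon$-embedding for a subspace $\mathcal{S}\subset\mathbb{R}^n$ (with $\epsilon\in[0,1)$) if $(1-\epsilon)\|x\|^2\le\|\Omega x\|^2\le(1+\epsilon)\|x\|^2$ for all $x\in\mathcal{S}$. Vectors $x,y$ are $\Omega$-orthogonal if $(\Omega x)^T(\Omega y)=0$; a matrix $V$ with $m$ columns is $\Omega$-orthonormal if $(\Omega V)^T(\Omega V)=I_m$. Randomized Arnoldi factorization of length $m$ (here $m=k+p$): given $v_1\in\mathbb{R}^n$ with $\|\Omega v_1\|=1$, let $\mathcal{K}_m=\mathrm{span}\{v_1,Av_1,\dots,A^{m-1}v_1\}$ be of dimension $m$ and let $\Omega$ be an $\epsilon$-embedding for $\mathrm{span}\{\mathcal{K}_m,A\mathcal{K}_m\}$. The factorization is $AV=VH_m+r_me_m^T$, with $V\in\mathbb{R}^{n\times m}$ an $\Omega$-orthonormal basis of $\mathcal{K}_m$, $V(:,1)=v_1$, $H_m\in\mathbb{R}^{m\times m}$ upper Hessenberg with positive subdiagonal entries (unreduced), and $r_m\in\mathcal{K}_{m+1}$ $\Omega$-orthogonal to $\mathcal{K}_m$. Here $e_j$ is the $j$-th canonical basis vector. Ritz pairs: if $H_m\tilde y_i=\tilde\lambda_i\tilde y_i$ with $\|\tilde y_i\|=1$, the Ritz value is $\tilde\lambda_i$ and the associated Ritz vector is $\tilde u_i=V\tilde y_i$.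 The spectrum of $H_{k+p}$ is split arbitrarily into $k$ wanted values $\{\tilde\lambda_1,\dots,\tilde\lambda_k\}$ and $p$ unwanted values $\{\tilde\lambda_{k+1},\dots,\tilde\lambda_{k+p}\}$, complex conjugate pairs being kept in the same subset. Shifted QR steps: set $H^+:=H_{k+p}$; for $i=1,\dots,p$, compute a QR factorization $H^+-\mu_iI=Q^iR^i$ with $Q^i$ orthogonal (unitary if complex shifts are used) and $R^i$ upper triangular, then replace $H^+$ by $(Q^i)^TH^+Q^i=R^iQ^i+\mu_iI$ (conjugate transpose in the complex case). Spans are over $\mathbb{C}$ when complex vectors occur.
   Formalization: The wanted Ritz values are assumed pairwise distinct; if one is repeated, the Ritz vectors span fewer than k dimensions (eigenspaces of an unreduced Hessenberg matrix are one-dimensional) while VQ_1 has rank k, so the claim fails. Unwanted values may repeat. *)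

theory Defs
  imports
    Complex_Main
    Jordan_Normal_Form.Char_Poly
    Jordan_Normal_Form.Schur_Decomposition
    Jordan_Normal_Form.DL_Rank
begin

text \<open>
  Matrices and vectors have explicit dimensions and are indexed from 0: the column written
  \<open>V(:,1)\<close> on paper is \<open>col V 0\<close>, and \<open>e\<^sub>m\<close> is \<open>unit_vec m (m - 1)\<close>.
\<close>

definition vec_norm :: "'a::real_normed_vector vec \<Rightarrow> real" where
  "vec_norm v = sqrt (\<Sum>i<dim_vec v. (norm (v $ i))\<^sup>2)"

abbreviation cmat :: "real mat \<Rightarrow> complex mat" where
  "cmat \<equiv> map_mat complex_of_real"

abbreviation cvec :: "real vec \<Rightarrow> complex vec" where
  "cvec \<equiv> map_vec complex_of_real"

text \<open>The linear span, over the scalar field \<open>'a\<close>, of a set of vectors of dimension \<open>n\<close>.\<close>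

abbreviation vspan :: "nat \<Rightarrow> 'a::field vec set \<Rightarrow> 'a vec set" where
  "vspan n \<equiv> LinearCombinations.module.span class_ring (module_vec TYPE('a) n)"

abbreviation colspan :: "nat \<Rightarrow> 'a::field mat \<Rightarrow> 'a vec set" where
  "colspan n \<equiv> vec_space.col_space n"


subsection \<open>Sketching\<close>

definition eps_embedding :: "real mat \<Rightarrow> real \<Rightarrow> real vec set \<Rightarrow> bool" where
  "eps_embedding \<Omega> \<epsilon> S \<longleftrightarrow> 0 \<le> \<epsilon> \<and> \<epsilon> < 1 \<and>
     (\<forall>x\<in>S. (1 - \<epsilon>) * (vec_norm x)\<^sup>2 \<le> (vec_norm (\<Omega> *\<^sub>v x))\<^sup>2 \<and>
            (vec_norm (\<Omega> *\<^sub>v x))\<^sup>2 \<le> (1 + \<epsilon>) * (vec_norm x)\<^sup>2)"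

definition sketch_orthogonal :: "real mat \<Rightarrow> real vec \<Rightarrow> real vec \<Rightarrow> bool" where
  "sketch_orthogonal \<Omega> x y \<longleftrightarrow> (\<Omega> *\<^sub>v x) \<bullet> (\<Omega> *\<^sub>v y) = 0"

definition sketch_orthonormal :: "real mat \<Rightarrow> real mat \<Rightarrow> bool" where
  "sketch_orthonormal \<Omega> V \<longleftrightarrow> (\<Omega> * V)\<^sup>T * (\<Omega> * V) = 1\<^sub>m (dim_col V)"


subsection \<open>Randomized Arnoldi factorization\<close>

definition krylov_mat :: "nat \<Rightarrow> real mat \<Rightarrow> real vec \<Rightarrow> nat \<Rightarrow> real mat" where
  "krylov_mat n A v m = mat_of_cols n (map (\<lambda>i. (A ^\<^sub>m i) *\<^sub>v v) [0..<m])"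

definition krylov :: "nat \<Rightarrow> real mat \<Rightarrow> real vec \<Rightarrow> nat \<Rightarrow> real vec set" where
  "krylov n A v m = colspan n (krylov_mat n A v m)"

definition unreduced_hessenberg :: "real mat \<Rightarrow> bool" where
  "unreduced_hessenberg H \<longleftrightarrow>
     (\<forall>i<dim_row H. \<forall>j<dim_col H. Suc j < i \<longrightarrow> H $$ (i, j) = 0) \<and>
     (\<forall>j. Suc j < dim_row H \<longrightarrow> H $$ (Suc j, j) > 0)"

text \<open>
  \<open>vec_space.rank\<close> is by definition the dimension of the span of the columns, so the rank
  condition says that the Krylov space has dimension \<open>m\<close>. The residual \<open>r\<close> may be zero.
\<close>

definition randomized_arnoldi ::
  "nat \<Rightarrow> nat \<Rightarrow> nat \<Rightarrow> real mat \<Rightarrow> real \<Rightarrow> real mat \<Rightarrow> real vec \<Rightarrow>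
   real mat \<Rightarrow> real mat \<Rightarrow> real vec \<Rightarrow> bool" where
  "randomized_arnoldi n d m \<Omega> \<epsilon> A v1 V H r \<longleftrightarrow>
     0 < m \<and>
     A \<in> carrier_mat n n \<and> \<Omega> \<in> carrier_mat d n \<and> v1 \<in> carrier_vec n \<and>
     vec_norm (\<Omega> *\<^sub>v v1) = 1 \<and>
     vec_space.rank n (krylov_mat n A v1 m) = m \<and>
     eps_embedding \<Omega> \<epsilon> (vspan n (krylov n A v1 m \<union> (\<lambda>x. A *\<^sub>v x) ` krylov n A v1 m)) \<and>
     V \<in> carrier_mat n m \<and> sketch_orthonormal \<Omega> V \<and>
     colspan n V = krylov n A v1 m \<and> col V 0 = v1 \<and>
     H \<in> carrier_mat m m \<and> unreduced_hessenberg H \<and>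
     r \<in> krylov n A v1 (m + 1) \<and> (\<forall>x\<in>krylov n A v1 m. sketch_orthogonal \<Omega> r x) \<and>
     A * V = V * H + mat_of_cols n [r] * mat_of_rows m [unit_vec m (m - 1)]"


subsection \<open>Ritz pairs\<close>

text \<open>\<open>ritz_pair V H \<theta> y u\<close>: \<open>\<theta>\<close> is a Ritz value, with normalized eigenvector \<open>y\<close> of \<open>H\<close> and
  Ritz vector \<open>u\<close>. The real matrices are viewed as complex ones because \<open>\<theta>\<close> may be nonreal.\<close>

definition ritz_pair ::
  "real mat \<Rightarrow> real mat \<Rightarrow> complex \<Rightarrow> complex vec \<Rightarrow> complex vec \<Rightarrow> bool" where
  "ritz_pair V H \<theta> y u \<longleftrightarrow>
     eigenvector (cmat H) y \<theta> \<and> vec_norm y = 1 \<and> u = cmat V *\<^sub>v y"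

text \<open>
  \<open>\<theta>s 0, \<dots>, \<theta>s (k + p - 1)\<close> lists the spectrum of \<open>H\<close>, each eigenvalue as often as its algebraic
  multiplicity. The first \<open>k\<close> entries are wanted; they are \<open>k\<close> different values, because the
  \<open>k\<close>-dimensional space obtained by restarting is not spanned by eigenvectors if a wanted value
  is repeated (the eigenspaces of an unreduced Hessenberg matrix are one-dimensional).
  An unwanted value may be repeated and may also coincide with a wanted one.
\<close>

definition ritz_split :: "real mat \<Rightarrow> nat \<Rightarrow> nat \<Rightarrow> (nat \<Rightarrow> complex) \<Rightarrow> bool" where
  "ritz_split H k p \<theta>s \<longleftrightarrow>
     char_poly (cmat H) = (\<Prod>i<k + p. [:- \<theta>s i, 1:]) \<and>
     inj_on \<theta>s {..<k} \<and>
     cnj ` \<theta>s ` {..<k} = \<theta>s ` {..<k} \<and>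
     cnj ` \<theta>s ` {k..<k + p} = \<theta>s ` {k..<k + p}"


subsection \<open>Shifted QR steps\<close>

definition qr_factorization :: "complex mat \<Rightarrow> complex mat \<Rightarrow> complex mat \<Rightarrow> bool" where
  "qr_factorization M Q R \<longleftrightarrow>
     Q \<in> carrier_mat (dim_row M) (dim_row M) \<and> R \<in> carrier_mat (dim_row M) (dim_col M) \<and>
     mat_adjoint Q * Q = 1\<^sub>m (dim_row M) \<and> upper_triangular R \<and> M = Q * R"

text \<open>
  Step \<open>i\<close> uses the shift \<open>\<mu> i\<close> and turns \<open>Hs i\<close> into \<open>Hs (Suc i)\<close>. The factorization is an
  arbitrary one: it is not unique, since with exact shifts the factored matrices are singular.
  Real shifts with real orthogonal factors are included as a special case.
\<close>

definition shifted_qr_steps ::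
  "nat \<Rightarrow> complex mat \<Rightarrow> (nat \<Rightarrow> complex) \<Rightarrow> (nat \<Rightarrow> complex mat) \<Rightarrow>
   (nat \<Rightarrow> complex mat) \<Rightarrow> (nat \<Rightarrow> complex mat) \<Rightarrow> bool" where
  "shifted_qr_steps p H \<mu> Hs Qs Rs \<longleftrightarrow>
     Hs 0 = H \<and>
     (\<forall>i<p. qr_factorization (Hs i - \<mu> i \<cdot>\<^sub>m 1\<^sub>m (dim_row H)) (Qs i) (Rs i) \<and>
            Hs (Suc i) = mat_adjoint (Qs i) * Hs i * Qs i)"

primrec accumulated_Q :: "nat \<Rightarrow> (nat \<Rightarrow> complex mat) \<Rightarrow> nat \<Rightarrow> complex mat" where
  "accumulated_Q m Qs 0 = 1\<^sub>m m"
| "accumulated_Q m Qs (Suc i) = accumulated_Q m Qs i * Qs i"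

definition first_cols :: "nat \<Rightarrow> 'a mat \<Rightarrow> 'a mat" where
  "first_cols k M = mat_of_cols (dim_row M) (take k (cols M))"

end

theory Submission
  imports Defs
begin

text \<open>
  Write \<open>m = k + p\<close> and let \<open>\<psi>\<close> be the product of the factors \<open>H - \<mu>\<^sub>i I\<close> over the \<open>p\<close> unwanted
  Ritz values. Everything happens inside the small space of dimension \<open>m\<close>: it is enough to relate
  \<open>Q\<^sub>1\<close> and the matrix \<open>Y\<close> of the wanted eigenvectors of \<open>H\<close>, because multiplying both by \<open>V\<close>
  preserves a relation \<open>Q\<^sub>1 = Y S\<close>. The comparison goes through a third matrix, the first \<open>k\<close>
  columns \<open>P\<close> of \<open>\<psi>\<close>.

  The QR steps compute a factorization \<open>\<psi> = Q R\<close> with \<open>R\<close> upper triangular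
  (\<open>shifted_qr_steps_factorization\<close>), so that \<open>P = Q\<^sub>1 R\<^sub>1\<close> with the leading block \<open>R\<^sub>1\<close> of \<open>R\<close>.
  By Cayley-Hamilton (\<open>shifted_product_char_poly_roots\<close>) the product of the wanted factors
  annihilates the columns of \<open>\<psi>\<close>. Its kernel is spanned by the wanted eigenvectors
  (\<open>hessenberg_kernel_shifted_product\<close>), since the wanted values are distinct and an unreduced
  Hessenberg matrix has one-dimensional eigenspaces. Hence also \<open>P = Y C\<close>.

  Finally \<open>P\<close> is injective: each factor \<open>H - \<mu> I\<close> moves the last nonzero position of a vector
  down by exactly one (\<open>shifted_last_nonzero_at\<close>), and starting within the first \<open>k\<close> positions there
  is room for all \<open>p\<close> of them. Therefore the square matrices \<open>R\<^sub>1\<close> and \<open>C\<close> are invertible, and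
  \<open>Q\<^sub>1\<close>, \<open>P\<close> and \<open>Y\<close> are obtained from one another by invertible right factors. For
  real data the real parts of the right factors do the same job over the reals (\<open>real_factor\<close>).
\<close>

section \<open>Entrywise formulas\<close>

lemma mult_mat_vec_index:
  assumes "M \<in> carrier_mat r c" and "v \<in> carrier_vec c" and "i < r"
  shows "(M *\<^sub>v v) $ i = (\<Sum>l<c. M $$ (i, l) * v $ l)"
  using assms by (auto simp: scalar_prod_def lessThan_atLeast0 intro!: sum.cong)

lemma mult_mat_index:
  assumes "M \<in> carrier_mat r s" and "N \<in> carrier_mat s c" and "i < r" and "j < c"
  shows "(M * N) $$ (i, j) = (\<Sum>l<s. M $$ (i, l) * N $$ (l, j))"
  using assms by (auto simp: scalar_prod_def lessThan_atLeast0 intro!: sum.cong)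

lemma mat_eq_if_mult_vec_eq:
  fixes M N :: "'a::comm_ring_1 mat"
  assumes M: "M \<in> carrier_mat r c" and N: "N \<in> carrier_mat r c"
    and eq: "\<And>x. x \<in> carrier_vec c \<Longrightarrow> M *\<^sub>v x = N *\<^sub>v x"
  shows "M = N"
proof (rule eq_matI)
  fix i j assume ij: "i < dim_row N" "j < dim_col N"
  have "(M *\<^sub>v unit_vec c j) $ i = (N *\<^sub>v unit_vec c j) $ i"
    using eq by simp
  then show "M $$ (i, j) = N $$ (i, j)"
    using M N ij by simp
qed (use M N in auto)

section \<open>Products of shifted matrices\<close>

abbreviation shifted :: "'a::comm_ring_1 mat \<Rightarrow> 'a \<Rightarrow> 'a mat" where
  "shifted H a \<equiv> H - a \<cdot>\<^sub>m 1\<^sub>m (dim_row H)"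

text \<open>
  As all factors commute, the order matters only for the inductions below. The head of the list is
  the leftmost factor, hence the last element is the shift that is applied first.
\<close>

primrec shifted_product :: "'a::comm_ring_1 mat \<Rightarrow> 'a list \<Rightarrow> 'a mat" where
  "shifted_product H [] = 1\<^sub>m (dim_row H)"
| "shifted_product H (a # as) = shifted H a * shifted_product H as"

lemma shifted_carrier:
  "H \<in> carrier_mat m m \<Longrightarrow> shifted H a \<in> carrier_mat m m"
  by (auto simp: minus_carrier_mat)

lemma shifted_product_carrier:
  assumes "H \<in> carrier_mat m m"
  shows "shifted_product H as \<in> carrier_mat m m"
  using assms by (induction as) (auto intro: mult_carrier_mat)

lemma shifted_mult_vec_index:
  assumes H: "H \<in> carrier_mat m m" and x: "x \<in> carrier_vec m" and i: "i < m"
  shows "(shifted H a *\<^sub>v x) $ i = (\<Sum>l<m. H $$ (i, l) * x $ l) - a * x $ i"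
proof -
  have "(shifted H a *\<^sub>v x) $ i = (\<Sum>l<m. shifted H a $$ (i, l) * x $ l)"
    by (rule mult_mat_vec_index[OF shifted_carrier[OF H] x i])
  also have "\<dots> = (\<Sum>l<m. H $$ (i, l) * x $ l - (if l = i then a * x $ l else 0))"
    using H i by (intro sum.cong) (auto simp: algebra_simps)
  also have "\<dots> = (\<Sum>l<m. H $$ (i, l) * x $ l) - a * x $ i"
    using i by (simp add: sum_subtractf sum.delta)
  finally show ?thesis .
qed

lemma shifted_product_append:
  assumes H: "H \<in> carrier_mat m m"
  shows "shifted_product H (as @ bs) = shifted_product H as * shifted_product H bs"
proof (induction as)
  case Nil
  show ?case using left_mult_one_mat[OF shifted_product_carrier[OF H]] H by simp
next
  case (Cons a as)
  then show ?case
    using assoc_mult_mat[OF shifted_carrier[OF H] shifted_product_carrier[OF H]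
        shifted_product_carrier[OF H]] by simp
qed

text \<open>
  Shifts are compatible with a change of basis. This is used twice: for the Schur form of a matrix,
  and for the QR steps, where \<open>P\<close> is the product of the unitary factors so far.
\<close>

lemma shifted_intertwine:
  assumes A: "A \<in> carrier_mat m m" and B: "B \<in> carrier_mat m m"
    and P: "P \<in> carrier_mat m m" and AP: "A * P = P * B"
  shows "shifted A a * P = P * shifted B a"
proof -
  have "shifted A a * P = A * P - (a \<cdot>\<^sub>m 1\<^sub>m m) * P"
    using A P by (simp add: minus_mult_distrib_mat[of _ m m])
  also have "(a \<cdot>\<^sub>m 1\<^sub>m m) * P = P * (a \<cdot>\<^sub>m 1\<^sub>m m)"
    using P mult_smult_assoc_mat[OF one_carrier_mat P] mult_smult_distrib[OF P one_carrier_mat] by simp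
  also have "A * P - P * (a \<cdot>\<^sub>m 1\<^sub>m m) = P * shifted B a"
    using B P AP by (simp add: mult_minus_distrib_mat[of _ m m])
  finally show ?thesis .
qed

lemma shifted_product_intertwine:
  assumes A: "A \<in> carrier_mat m m" and B: "B \<in> carrier_mat m m"
    and P: "P \<in> carrier_mat m m" and AP: "A * P = P * B"
  shows "shifted_product A as * P = P * shifted_product B as"
proof (induction as)
  case Nil
  show ?case using A B P by simp
next
  case (Cons a as)
  note c = shifted_carrier[OF A, of a] shifted_carrier[OF B, of a]
    shifted_product_carrier[OF A, of as] shifted_product_carrier[OF B, of as]
  have "shifted_product A (a # as) * P = shifted A a * (P * shifted_product B as)"
    using assoc_mult_mat[OF c(1) c(3) P] Cons by simp
  also have "\<dots> = P * (shifted B a * shifted_product B as)"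
    using assoc_mult_mat[OF c(1) P c(4)] assoc_mult_mat[OF P c(2) c(4)]
      shifted_intertwine[OF A B P AP, of a] by simp
  finally show ?case by simp
qed

text \<open>
  A triangular matrix maps the span of the first \<open>j + 1\<close> unit vectors into itself, and subtracting
  its diagonal entry at \<open>j\<close> removes the last coordinate. So each factor lowers the flag by
  one step until nothing is left.
\<close>

lemma triangular_shifted_product_vec:
  assumes B: "B \<in> carrier_mat m m" and tri: "upper_triangular B"
    and j: "j \<le> m" and x: "x \<in> carrier_vec m" and z: "\<forall>i<m. j \<le> i \<longrightarrow> x $ i = 0"
  shows "shifted_product B (take j (diag_mat B)) *\<^sub>v x = 0\<^sub>v m"
  using j x z
proof (induction j arbitrary: x)
  case 0
  then have "x = 0\<^sub>v m" by (intro eq_vecI) auto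
  then show ?case using B by simp
next
  case (Suc j)
  let ?S = "shifted B (B $$ (j, j))"
  have Sx: "?S *\<^sub>v x \<in> carrier_vec m"
    by (rule mult_mat_vec_carrier[OF shifted_carrier[OF B] Suc.prems(2)])
  have "(?S *\<^sub>v x) $ i = 0" if i: "i < m" "j \<le> i" for i
  proof -
    have "(\<Sum>l<m. B $$ (i, l) * x $ l) = (\<Sum>l<m. if l = i then B $$ (i, i) * x $ i else 0)"
    proof (intro sum.cong refl)
      fix l assume l: "l \<in> {..<m}"
      show "B $$ (i, l) * x $ l = (if l = i then B $$ (i, i) * x $ i else 0)"
        using l i Suc.prems(3) upper_triangularD[OF tri, of l i] B
        by (cases l i rule: linorder_cases) auto
    qed
    then have "(?S *\<^sub>v x) $ i = (B $$ (i, i) - B $$ (j, j)) * x $ i"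
      using shifted_mult_vec_index[OF B Suc.prems(2) i(1), of "B $$ (j, j)"] i by (simp add: algebra_simps)
    moreover have "i = j \<or> x $ i = 0" using i Suc.prems(3) by auto
    ultimately show ?thesis by auto
  qed
  then have IH: "shifted_product B (take j (diag_mat B)) *\<^sub>v (?S *\<^sub>v x) = 0\<^sub>v m"
    using Suc.IH[OF _ Sx] Suc.prems(1) by auto
  have "take (Suc j) (diag_mat B) = take j (diag_mat B) @ [B $$ (j, j)]"
    using Suc.prems(1) B by (simp add: take_Suc_conv_app_nth diag_mat_def)
  then have "shifted_product B (take (Suc j) (diag_mat B))
      = shifted_product B (take j (diag_mat B)) * ?S"
    using shifted_product_append[OF B, of "take j (diag_mat B)" "[B $$ (j, j)]"]
      right_mult_one_mat[OF shifted_carrier[OF B, of "B $$ (j, j)"]] B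
    by simp
  then show ?case
    using IH assoc_mult_mat_vec[OF shifted_product_carrier[OF B] shifted_carrier[OF B] Suc.prems(2)]
    by simp
qed

lemma triangular_shifted_product:
  assumes B: "B \<in> carrier_mat m m" and tri: "upper_triangular B"
  shows "shifted_product B (diag_mat B) = 0\<^sub>m m m"
proof (rule mat_eq_if_mult_vec_eq[OF shifted_product_carrier[OF B]])
  fix x :: "'a vec" assume "x \<in> carrier_vec m"
  then show "shifted_product B (diag_mat B) *\<^sub>v x = 0\<^sub>m m m *\<^sub>v x"
    using triangular_shifted_product_vec[OF B tri order_refl, of x] B
    by (auto simp: diag_mat_def scalar_prod_def intro!: eq_vecI)
qed simp

text \<open>
  This is the theorem of Cayley and Hamilton for a split characteristic polynomial. The Schur
  decomposition produces a triangular matrix whose diagonal lists the eigenvalues in the order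
  \<open>es\<close>, which reduces the claim to the triangular case.
\<close>

theorem shifted_product_char_poly_roots:
  fixes A :: "'a::conjugatable_ordered_field mat"
  assumes A: "A \<in> carrier_mat m m" and cp: "char_poly A = (\<Prod>e\<leftarrow>es. [:- e, 1:])"
  shows "shifted_product A es = 0\<^sub>m m m"
proof -
  obtain B P Q where s: "schur_decomposition A es = (B, P, Q)"
    by (cases "schur_decomposition A es") auto
  have sim: "similar_mat_wit A B P Q" and tri: "upper_triangular B" and d: "diag_mat B = es"
    using schur_decomposition[OF A cp s] by auto
  note w = similar_mat_witD2[OF A sim]
  have "A * P = P * B * (Q * P)"
    using w(3) assoc_mult_mat[OF mult_carrier_mat[OF w(6) w(5)] w(7) w(6)] by simp
  then have AP: "A * P = P * B"
    using w(2) right_mult_one_mat[OF mult_carrier_mat[OF w(6) w(5)]] by simp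
  have "shifted_product A es * P = 0\<^sub>m m m"
    using shifted_product_intertwine[OF A w(5) w(6) AP, of es]
      triangular_shifted_product[OF w(5) tri] right_mult_zero_mat[OF w(6)] d by simp
  then have "shifted_product A es * (P * Q) = 0\<^sub>m m m"
    using assoc_mult_mat[OF shifted_product_carrier[OF A, of es] w(6) w(7), symmetric] left_mult_zero_mat[OF w(7)]
    by simp
  then show ?thesis
    using w(1) right_mult_one_mat[OF shifted_product_carrier[OF A]] by simp
qed

section \<open>Unreduced Hessenberg matrices\<close>

text \<open>
  The counterpart of an unreduced Hessenberg matrix over an arbitrary field, such as the complex
  numbers in which the Ritz values live: a positive subdiagonal becomes a nonvanishing one.
\<close>

definition nonzero_subdiag_hessenberg :: "nat \<Rightarrow> 'a::zero mat \<Rightarrow> bool" where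
  "nonzero_subdiag_hessenberg m H \<longleftrightarrow> H \<in> carrier_mat m m \<and>
     (\<forall>i<m. \<forall>j<m. Suc j < i \<longrightarrow> H $$ (i, j) = 0) \<and>
     (\<forall>j. Suc j < m \<longrightarrow> H $$ (Suc j, j) \<noteq> 0)"

lemma nonzero_subdiag_hessenberg_carrier:
  "nonzero_subdiag_hessenberg m H \<Longrightarrow> H \<in> carrier_mat m m"
  unfolding nonzero_subdiag_hessenberg_def by simp

definition last_nonzero_at :: "'a::zero vec \<Rightarrow> nat \<Rightarrow> bool" where
  "last_nonzero_at x j \<longleftrightarrow> j < dim_vec x \<and> x $ j \<noteq> 0 \<and> (\<forall>i<dim_vec x. j < i \<longrightarrow> x $ i = 0)"

lemma last_nonzero_at_exists:
  assumes x: "x \<in> carrier_vec m" and nz: "x \<noteq> 0\<^sub>v m"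
  shows "\<exists>j<m. last_nonzero_at x j"
proof -
  let ?I = "{i. i < m \<and> x $ i \<noteq> 0}"
  have "?I \<noteq> {}" using x nz by (auto intro!: eq_vecI)
  then have "Max ?I \<in> ?I" by (intro Max_in) auto
  moreover have "\<forall>i<m. Max ?I < i \<longrightarrow> x $ i = 0"
    using Max_ge[of ?I] by fastforce
  ultimately have "Max ?I < m \<and> last_nonzero_at x (Max ?I)"
    using carrier_vecD[OF x] unfolding last_nonzero_at_def by blast
  then show ?thesis by blast
qed

text \<open>
  Row \<open>j + 1\<close> meets the support of \<open>x\<close> only in the subdiagonal entry at \<open>(j + 1, j)\<close>, the rows below do
  not meet it at all, and the shift changes only positions up to \<open>j\<close>.
\<close>

lemma shifted_last_nonzero_at:
  fixes H :: "'a::idom mat"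
  assumes H: "nonzero_subdiag_hessenberg m H" and x: "x \<in> carrier_vec m"
    and j: "last_nonzero_at x j" and jm: "Suc j < m"
  shows "last_nonzero_at (shifted H a *\<^sub>v x) (Suc j)"
proof -
  have Hc: "H \<in> carrier_mat m m" and H0: "\<And>i j. i < m \<Longrightarrow> j < m \<Longrightarrow> Suc j < i \<Longrightarrow> H $$ (i, j) = 0"
    and H1: "H $$ (Suc j, j) \<noteq> 0"
    using H jm unfolding nonzero_subdiag_hessenberg_def by auto
  have xj: "x $ j \<noteq> 0" and x0: "\<And>i. i < m \<Longrightarrow> j < i \<Longrightarrow> x $ i = 0"
    using j x unfolding last_nonzero_at_def by auto
  have val: "(shifted H a *\<^sub>v x) $ i = (if i = Suc j then H $$ (Suc j, j) * x $ j else 0)"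
    if i: "i < m" "j < i" for i
  proof -
    have "(\<Sum>l<m. H $$ (i, l) * x $ l)
        = (\<Sum>l<m. if l = j then (if i = Suc j then H $$ (Suc j, j) * x $ j else 0) else 0)"
    proof (intro sum.cong refl)
      fix l assume l: "l \<in> {..<m}"
      show "H $$ (i, l) * x $ l
          = (if l = j then (if i = Suc j then H $$ (Suc j, j) * x $ j else 0) else 0)"
        using l i x0[of l] H0[of i l] by (cases l j rule: linorder_cases) auto
    qed
    then show ?thesis
      using shifted_mult_vec_index[OF Hc x i(1), of a] x0[OF i] jm by simp
  qed
  show ?thesis
    unfolding last_nonzero_at_def using val[of "Suc j"] val jm xj H1 Hc by auto
qed

lemma shifted_product_last_nonzero_at:
  fixes H :: "'a::idom mat"
  assumes H: "nonzero_subdiag_hessenberg m H" and x: "x \<in> carrier_vec m"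
    and j: "last_nonzero_at x j" and jm: "j + length as < m"
  shows "last_nonzero_at (shifted_product H as *\<^sub>v x) (j + length as)"
  using jm
proof (induction as)
  case Nil
  then show ?case using nonzero_subdiag_hessenberg_carrier[OF H] x j by simp
next
  case (Cons a as)
  note Hc = nonzero_subdiag_hessenberg_carrier[OF H]
  have "last_nonzero_at (shifted_product H as *\<^sub>v x) (j + length as)"
    using Cons by simp
  from shifted_last_nonzero_at[OF H mult_mat_vec_carrier[OF shifted_product_carrier[OF Hc] x] this]
  show ?case
    using assoc_mult_mat_vec[OF shifted_carrier[OF Hc] shifted_product_carrier[OF Hc] x] Cons.prems
    by simp
qed

text \<open>
  The last nonzero position of an eigenvector must be the very last coordinate, for otherwise
  \<open>H - a I\<close> would move it down to a nonzero entry. Subtracting a multiple of \<open>y\<close> from \<open>x\<close> clears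
  that coordinate and leaves a vector that has to vanish.
\<close>

lemma hessenberg_eigenspace_one_dim:
  fixes H :: "'a::field mat"
  assumes H: "nonzero_subdiag_hessenberg m H"
    and y: "y \<in> carrier_vec m" "y \<noteq> 0\<^sub>v m" "shifted H a *\<^sub>v y = 0\<^sub>v m"
    and x: "x \<in> carrier_vec m" "shifted H a *\<^sub>v x = 0\<^sub>v m"
  shows "\<exists>c. x = c \<cdot>\<^sub>v y"
proof -
  note Hc = nonzero_subdiag_hessenberg_carrier[OF H]
  have last: "Suc j = m" if w: "w \<in> carrier_vec m" "shifted H a *\<^sub>v w = 0\<^sub>v m" "last_nonzero_at w j" for w j
  proof (rule ccontr)
    assume "Suc j \<noteq> m"
    then have "Suc j < m" using w unfolding last_nonzero_at_def by auto
    from shifted_last_nonzero_at[OF H w(1,3) this, of a] this show False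
      unfolding w(2) last_nonzero_at_def by simp
  qed
  obtain j where j: "last_nonzero_at y j" using last_nonzero_at_exists[OF y(1,2)] by auto
  have jm: "Suc j = m" and yj: "y $ j \<noteq> 0"
    using last[OF y(1,3) j] j unfolding last_nonzero_at_def by auto
  let ?c = "x $ j / y $ j"
  let ?w = "x - ?c \<cdot>\<^sub>v y"
  have w: "?w \<in> carrier_vec m" using x y by simp
  have "shifted H a *\<^sub>v ?w = 0\<^sub>v m"
    using x y mult_minus_distrib_mat_vec[OF shifted_carrier[OF Hc, of a] x(1), of "?c \<cdot>\<^sub>v y"]
      mult_mat_vec[OF shifted_carrier[OF Hc, of a] y(1), of ?c]
    by (auto intro!: eq_vecI)
  moreover have "?w $ j = 0" using x y jm yj by simp
  ultimately have w0: "?w = 0\<^sub>v m"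
    using last[OF w] last_nonzero_at_exists[OF w] jm unfolding last_nonzero_at_def by blast
  have "x = ?c \<cdot>\<^sub>v y"
  proof (rule eq_vecI)
    fix i assume "i < dim_vec (?c \<cdot>\<^sub>v y)"
    then show "x $ i = (?c \<cdot>\<^sub>v y) $ i"
      using arg_cong[OF w0, of "\<lambda>v. v $ i"] x y by simp
  qed (use x y in simp)
  then show ?thesis ..
qed

text \<open>
  Induction on the number of factors. If \<open>x\<close> lies in the kernel for \<open>k + 1\<close> values, then
  \<open>(H - \<theta>\<^sub>k I) x\<close> is a combination of \<open>y\<^sub>0, \<dots>, y\<^bsub>k-1\<^esub>\<close>. On the span of these vectors
  \<open>H - \<theta>\<^sub>k I\<close> is diagonal with the nonzero entries \<open>\<theta>\<^sub>j - \<theta>\<^sub>k\<close>, so it can be inverted there; the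
  difference between \<open>x\<close> and this preimage is in the eigenspace of \<open>\<theta>\<^sub>k\<close>.
\<close>

lemma hessenberg_kernel_shifted_product:
  fixes H :: "'a::field mat"
  assumes H: "nonzero_subdiag_hessenberg m H"
    and y: "\<And>j. j < k \<Longrightarrow> y j \<in> carrier_vec m" "\<And>j. j < k \<Longrightarrow> y j \<noteq> 0\<^sub>v m"
      "\<And>j. j < k \<Longrightarrow> shifted H (\<theta> j) *\<^sub>v y j = 0\<^sub>v m"
    and inj: "inj_on \<theta> {..<k}"
    and x: "x \<in> carrier_vec m" "shifted_product H (map \<theta> [0..<k]) *\<^sub>v x = 0\<^sub>v m"
  shows "\<exists>c. \<forall>i<m. x $ i = (\<Sum>j<k. c j * y j $ i)"
  using y inj x
proof (induction k arbitrary: x)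
  case 0
  from nonzero_subdiag_hessenberg_carrier[OF H] 0 show ?case by simp
next
  case (Suc k)
  note Hc = nonzero_subdiag_hessenberg_carrier[OF H]
  let ?S = "shifted H (\<theta> k)"
  note S = shifted_carrier[OF Hc, of "\<theta> k"]
  have Sx: "?S *\<^sub>v x \<in> carrier_vec m"
    by (rule mult_mat_vec_carrier[OF S Suc.prems(5)])
  have "shifted_product H (map \<theta> [0..<Suc k]) = shifted_product H (map \<theta> [0..<k]) * ?S"
    using shifted_product_append[OF Hc, of "map \<theta> [0..<k]" "[\<theta> k]"] right_mult_one_mat[OF S] Hc
    by simp
  then have "shifted_product H (map \<theta> [0..<k]) *\<^sub>v (?S *\<^sub>v x) = 0\<^sub>v m"
    using Suc.prems(6) assoc_mult_mat_vec[OF shifted_product_carrier[OF Hc] S Suc.prems(5)] by simp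
  moreover have "inj_on \<theta> {..<k}" using Suc.prems(4) by (rule inj_on_subset) auto
  ultimately obtain c where c: "\<forall>i<m. (?S *\<^sub>v x) $ i = (\<Sum>j<k. c j * y j $ i)"
    using Suc.IH[OF _ _ _ _ Sx] Suc.prems(1-3) by force
  have ne: "\<theta> j - \<theta> k \<noteq> 0" if "j < k" for j
    using Suc.prems(4) that unfolding inj_on_def by force
  \<comment> \<open>The coefficients of the preimage of \<open>?S x\<close> in the span of the earlier eigenvectors.\<close>
  define b where "b j = c j / (\<theta> j - \<theta> k)" for j
  define z where "z = vec m (\<lambda>i. x $ i - (\<Sum>j<k. b j * y j $ i))"
  have z: "z \<in> carrier_vec m" unfolding z_def by simp
  have Sy: "(\<Sum>l<m. ?S $$ (i, l) * y j $ l) = (\<theta> j - \<theta> k) * y j $ i" if ij: "i < m" "j < k" for i j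
  proof -
    have yj: "y j \<in> carrier_vec m" using Suc.prems(1) ij by simp
    have "(\<Sum>l<m. H $$ (i, l) * y j $ l) = \<theta> j * y j $ i"
      using shifted_mult_vec_index[OF Hc yj ij(1), of "\<theta> j"] Suc.prems(3)[of j] ij by simp
    then show ?thesis
      using shifted_mult_vec_index[OF Hc yj ij(1), of "\<theta> k"] mult_mat_vec_index[OF S yj ij(1)]
      by (simp add: algebra_simps)
  qed
  have "?S *\<^sub>v z = 0\<^sub>v m"
  proof (rule eq_vecI)
    fix i assume "i < dim_vec (0\<^sub>v m :: 'a vec)"
    then have i: "i < m" by simp
    have "(?S *\<^sub>v z) $ i = (\<Sum>l<m. ?S $$ (i, l) * x $ l - (\<Sum>j<k. b j * (?S $$ (i, l) * y j $ l)))"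
      unfolding mult_mat_vec_index[OF S z i]
      by (intro sum.cong refl)
        (simp add: z_def right_diff_distrib sum_distrib_left mult.left_commute)
    also have "\<dots> = (?S *\<^sub>v x) $ i - (\<Sum>l<m. \<Sum>j<k. b j * (?S $$ (i, l) * y j $ l))"
      by (simp add: sum_subtractf mult_mat_vec_index[OF S Suc.prems(5) i])
    also have "(\<Sum>l<m. \<Sum>j<k. b j * (?S $$ (i, l) * y j $ l)) = (\<Sum>j<k. b j * ((\<theta> j - \<theta> k) * y j $ i))"
      by (subst sum.swap) (intro sum.cong refl, simp only: sum_distrib_left[symmetric], simp add: Sy i)
    also have "\<dots> = (?S *\<^sub>v x) $ i"
      using c i ne by (auto simp: b_def intro!: sum.cong)
    finally show "(?S *\<^sub>v z) $ i = 0\<^sub>v m $ i" using i by simp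
  qed (use Hc in simp)
  then obtain e where e: "z = e \<cdot>\<^sub>v y k"
    using hessenberg_eigenspace_one_dim[OF H Suc.prems(1,2,3)[of k] z] by auto
  have "x $ i = (\<Sum>j<Suc k. (b(k := e)) j * y j $ i)" if i: "i < m" for i
  proof -
    have "x $ i - (\<Sum>j<k. b j * y j $ i) = e * y k $ i"
      using arg_cong[OF e, of "\<lambda>v. v $ i"] i Suc.prems(1)[of k] unfolding z_def by simp
    then show ?thesis by (simp add: algebra_simps)
  qed
  then show ?case by blast
qed

section \<open>Shifted QR steps\<close>

lemma upper_triangular_mult:
  fixes R S :: "'a::semiring_0 mat"
  assumes R: "R \<in> carrier_mat m m" "upper_triangular R"
    and S: "S \<in> carrier_mat m m" "upper_triangular S"
  shows "upper_triangular (R * S)"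
proof (rule upper_triangularI)
  fix i j assume ij: "j < i" "i < dim_row (R * S)"
  then have i: "i < m" "j < m" using R by auto
  have "R $$ (i, l) * S $$ (l, j) = 0" if "l < m" for l
    using upper_triangularD[OF R(2), of l i] upper_triangularD[OF S(2), of j l] R S ij i that
    by (cases "l < i") auto
  then show "(R * S) $$ (i, j) = 0"
    unfolding mult_mat_index[OF R(1) S(1) i] by (intro sum.neutral) auto
qed

text \<open>
  With \<open>G\<close> the accumulated unitary factor, the invariant is \<open>H G = G H\<^sub>i\<close> together with
  \<open>\<psi>\<^sub>i = G R\<close>. A further step with \<open>H\<^sub>i - \<mu> I = Q\<^sub>i R\<^sub>i\<close> gives
  \<open>(H - \<mu> I) G R = G (H\<^sub>i - \<mu> I) R = (G Q\<^sub>i) (R\<^sub>i R)\<close>, which is again of the required form.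
  The list of shifts is reversed because the newest factor stands on the left.
\<close>

theorem shifted_qr_steps_factorization:
  assumes steps: "shifted_qr_steps p H \<mu> Hs Qs Rs" and H: "H \<in> carrier_mat m m" and "i \<le> p"
  shows "\<exists>R. R \<in> carrier_mat m m \<and> upper_triangular R \<and>
    accumulated_Q m Qs i \<in> carrier_mat m m \<and> Hs i \<in> carrier_mat m m \<and>
    H * accumulated_Q m Qs i = accumulated_Q m Qs i * Hs i \<and>
    shifted_product H (rev (map \<mu> [0..<i])) = accumulated_Q m Qs i * R"
  using \<open>i \<le> p\<close>
proof (induction i)
  case 0
  show ?case
    using steps H unfolding shifted_qr_steps_def
    by (intro exI[of _ "1\<^sub>m m"]) auto
next
  case (Suc i)
  let ?G = "accumulated_Q m Qs i"
  let ?Q = "Qs i"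
  obtain R where R: "R \<in> carrier_mat m m" "upper_triangular R"
    and G: "?G \<in> carrier_mat m m" and Hi: "Hs i \<in> carrier_mat m m"
    and HG: "H * ?G = ?G * Hs i"
    and prod: "shifted_product H (rev (map \<mu> [0..<i])) = ?G * R"
    using Suc by auto
  have "qr_factorization (shifted (Hs i) (\<mu> i)) ?Q (Rs i)"
    and Hs': "Hs (Suc i) = mat_adjoint ?Q * Hs i * ?Q"
    using steps Suc.prems H Hi unfolding shifted_qr_steps_def by auto
  then have Q: "?Q \<in> carrier_mat m m" and Ri: "Rs i \<in> carrier_mat m m" "upper_triangular (Rs i)"
    and QQ: "mat_adjoint ?Q * ?Q = 1\<^sub>m m" and fac: "shifted (Hs i) (\<mu> i) = ?Q * Rs i"
    using Hi shifted_carrier[OF Hi, of "\<mu> i"] unfolding qr_factorization_def by auto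
  have Qa: "mat_adjoint ?Q \<in> carrier_mat m m"
    using Q by (auto simp: mat_adjoint_def mat_of_rows_def)
  have QQ': "?Q * mat_adjoint ?Q = 1\<^sub>m m"
    by (rule mat_mult_left_right_inverse[OF Qa Q QQ])
  note GQ = mult_carrier_mat[OF G Q]
  have Hsc: "Hs (Suc i) \<in> carrier_mat m m"
    unfolding Hs' by (rule mult_carrier_mat[OF mult_carrier_mat[OF Qa Hi] Q])
  note HQ = mult_carrier_mat[OF Hi Q]
  have "?Q * Hs (Suc i) = (?Q * mat_adjoint ?Q) * (Hs i * ?Q)"
    unfolding Hs' using assoc_mult_mat[OF Qa Hi Q] assoc_mult_mat[OF Q Qa HQ] by simp
  then have step: "?Q * Hs (Suc i) = Hs i * ?Q"
    using QQ' left_mult_one_mat[OF HQ] by simp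
  have "H * (?G * ?Q) = (?G * Hs i) * ?Q"
    using HG assoc_mult_mat[OF H G Q] by simp
  also have "\<dots> = (?G * ?Q) * Hs (Suc i)"
    using step assoc_mult_mat[OF G Hi Q] assoc_mult_mat[OF G Q Hsc] by simp
  finally have HGQ: "H * (?G * ?Q) = (?G * ?Q) * Hs (Suc i)" .
  have "shifted_product H (rev (map \<mu> [0..<Suc i])) = shifted H (\<mu> i) * (?G * R)"
    using prod by simp
  also have "\<dots> = ?G * shifted (Hs i) (\<mu> i) * R"
    using assoc_mult_mat[OF shifted_carrier[OF H] G R(1)] shifted_intertwine[OF H Hi G HG] by simp
  also have "\<dots> = (?G * ?Q) * (Rs i * R)"
    unfolding fac using assoc_mult_mat[OF G Q Ri(1)] assoc_mult_mat[OF GQ Ri(1) R(1)] by simp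
  finally have "shifted_product H (rev (map \<mu> [0..<Suc i])) = (?G * ?Q) * (Rs i * R)" .
  then show ?case
    using upper_triangular_mult[OF Ri R] mult_carrier_mat[OF Ri(1) R(1)] GQ Hsc HGQ by auto
qed

section \<open>Column spaces\<close>

lemma mat_of_cols_carrier_length:
  "length vs = k \<Longrightarrow> mat_of_cols n vs \<in> carrier_mat n k"
  using mat_of_cols_carrier(1) by metis

lemma first_cols_carrier:
  assumes M: "M \<in> carrier_mat r c" and k: "k \<le> c"
  shows "first_cols k M \<in> carrier_mat r k"
proof -
  have "length (take k (cols M)) = k"
    unfolding length_take cols_length carrier_matD(2)[OF M] using k by (rule min.absorb2)
  then show ?thesis
    unfolding first_cols_def carrier_matD(1)[OF M] by (rule mat_of_cols_carrier_length)
qed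

lemma first_cols_index:
  assumes "M \<in> carrier_mat r c" and "k \<le> c" and "i < r" and "j < k"
  shows "first_cols k M $$ (i, j) = M $$ (i, j)"
  using assms by (simp add: first_cols_def mat_of_cols_index)

text \<open>
  Below row \<open>k\<close> the first \<open>k\<close> columns of \<open>R\<close> vanish, so only the first \<open>k\<close> columns of \<open>Q\<close> contribute.
\<close>

lemma first_cols_mult_upper_triangular:
  assumes Q: "Q \<in> carrier_mat m m" and R: "R \<in> carrier_mat m m" "upper_triangular R" and k: "k \<le> m"
  shows "first_cols k (Q * R) = first_cols k Q * mat k k (\<lambda>ij. R $$ ij)" (is "?L = ?M * ?R")
proof (rule eq_matI)
  note c = first_cols_carrier[OF Q k] first_cols_carrier[OF mult_carrier_mat[OF Q R(1)] k]
  fix i j assume "i < dim_row (?M * ?R)" "j < dim_col (?M * ?R)"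
  then have ij: "i < m" "j < k" using c by auto
  have "?L $$ (i, j) = (\<Sum>l<m. Q $$ (i, l) * R $$ (l, j))"
    using first_cols_index[OF mult_carrier_mat[OF Q R(1)] k ij] mult_mat_index[OF Q R(1) ij(1)] ij k
    by simp
  also have "\<dots> = (\<Sum>l<k. Q $$ (i, l) * R $$ (l, j))"
    using k ij upper_triangularD[OF R(2)] R(1) by (intro sum.mono_neutral_right) auto
  also have "\<dots> = (\<Sum>l<k. ?M $$ (i, l) * ?R $$ (l, j))"
    using first_cols_index[OF Q k ij(1)] ij by (intro sum.cong) auto
  also have "\<dots> = (?M * ?R) $$ (i, j)"
    by (rule mult_mat_index[symmetric, OF c(1) _ ij]) simp
  finally show "?L $$ (i, j) = (?M * ?R) $$ (i, j)" .
qed (simp_all add: carrier_matD[OF first_cols_carrier[OF Q k]]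
    carrier_matD[OF first_cols_carrier[OF mult_carrier_mat[OF Q R(1)] k]])

text \<open>
  Injectivity of \<open>B C\<close> makes the square factor \<open>C\<close> injective, hence invertible, and \<open>D\<close> is its inverse.
\<close>

lemma injective_factor:
  fixes B C :: "'a::field mat"
  assumes B: "B \<in> carrier_mat r k" and C: "C \<in> carrier_mat k k" and P: "P = B * C"
    and inj: "\<And>c. c \<in> carrier_vec k \<Longrightarrow> P *\<^sub>v c = 0\<^sub>v r \<Longrightarrow> c = 0\<^sub>v k"
  shows "\<exists>D\<in>carrier_mat k k. B = P * D"
proof -
  have "P *\<^sub>v c = 0\<^sub>v r" if "c \<in> carrier_vec k" "C *\<^sub>v c = 0\<^sub>v k" for c
    unfolding P using assoc_mult_mat_vec[OF B C that(1)] that(2) B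
    by (auto intro!: eq_vecI)
  then have "det C \<noteq> 0"
    using inj det_0_iff_vec_prod_zero[OF C] by blast
  from det_non_zero_imp_unit[OF C this] obtain D where D: "D \<in> carrier_mat k k" "C * D = 1\<^sub>m k"
    unfolding Units_def ring_mat_def by auto
  then have "B = P * D"
    unfolding P using assoc_mult_mat[OF B C D(1)] right_mult_one_mat[OF B] by simp
  with D show ?thesis by auto
qed

lemma colspan_mult_subset:
  fixes M S :: "'a::field mat"
  assumes M: "M \<in> carrier_mat n k" and S: "S \<in> carrier_mat k l"
  shows "colspan n (M * S) \<subseteq> colspan n M"
proof
  fix x assume "x \<in> colspan n (M * S)"
  then obtain c where c: "c \<in> carrier_vec l" "x \<in> carrier_vec n" "x = M * S *\<^sub>v c"
    using vec_space.col_space_eq[OF mult_carrier_mat[OF M S]] M S by auto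
  then have "x = M *\<^sub>v (S *\<^sub>v c)"
    using assoc_mult_mat_vec[OF M S c(1)] by simp
  then show "x \<in> colspan n M"
    using vec_space.col_space_eq[OF M] M c mult_mat_vec_carrier[OF S c(1)] by auto
qed

lemma colspan_eqI:
  fixes M N :: "'a::field mat"
  assumes M: "M \<in> carrier_mat n k" and N: "N \<in> carrier_mat n k"
    and S: "S \<in> carrier_mat k k" "M = N * S" and T: "T \<in> carrier_mat k k" "N = M * T"
  shows "colspan n M = colspan n N"
  using colspan_mult_subset[OF N S(1), folded S(2)] colspan_mult_subset[OF M T(1), folded T(2)]
  by (rule subset_antisym)

lemma colspan_eq_vspan:
  assumes M: "M \<in> carrier_mat n k" and col: "\<And>j. j < k \<Longrightarrow> col M j = u j"
  shows "colspan n M = vspan n (u ` {..<k})"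
proof -
  have "set (cols M) = u ` {..<k}" using M col unfolding cols_def by force
  then show ?thesis by (simp add: vec_space.col_space_def)
qed

text \<open>
  Over the complex numbers a real matrix may be a combination of real columns with nonreal
  coefficients; discarding their imaginary parts does not change the result.
\<close>

lemma real_factor:
  assumes M: "M \<in> carrier_mat n k" and N: "N \<in> carrier_mat n l" and S: "S \<in> carrier_mat l k"
    and eq: "cmat M = cmat N * S"
  shows "M = N * map_mat Re S"
proof (rule eq_matI)
  have S': "map_mat Re S \<in> carrier_mat l k" using S by simp
  fix i j assume "i < dim_row (N * map_mat Re S)" "j < dim_col (N * map_mat Re S)"
  then have ij: "i < n" "j < k" using N S by auto
  have cN: "cmat N \<in> carrier_mat n l" using N by simp
  have "M $$ (i, j) = Re (cmat M $$ (i, j))" using M ij by simp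
  also have "\<dots> = Re (\<Sum>t<l. cmat N $$ (i, t) * S $$ (t, j))"
    unfolding eq mult_mat_index[OF cN S ij] ..
  also have "\<dots> = (\<Sum>t<l. N $$ (i, t) * map_mat Re S $$ (t, j))"
    unfolding Re_sum using N S ij by (intro sum.cong) auto
  also have "\<dots> = (N * map_mat Re S) $$ (i, j)"
    by (rule mult_mat_index[symmetric, OF N S' ij])
  finally show "M $$ (i, j) = (N * map_mat Re S) $$ (i, j)" .
qed (use M N S in auto)

section \<open>The restarted basis\<close>

text \<open>
  Both \<open>Q1\<close> and \<open>Y\<close> are factors of the injective matrix formed by the first \<open>k\<close> columns of \<open>\<psi>\<close>, so
  each is obtained from that matrix by an invertible right factor.
\<close>

theorem exact_shift_factorizations:
  fixes H :: "complex mat"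
  assumes H: "nonzero_subdiag_hessenberg (k + p) H"
    and cp: "char_poly H = (\<Prod>i<k + p. [:- \<theta> i, 1:])" and inj: "inj_on \<theta> {..<k}"
    and y: "\<And>j. j < k \<Longrightarrow> eigenvector H (y j) (\<theta> j)"
    and steps: "shifted_qr_steps p H (\<lambda>i. \<theta> (k + i)) Hs Qs Rs"
  defines "Q1 \<equiv> first_cols k (accumulated_Q (k + p) Qs p)"
    and "Y \<equiv> mat_of_cols (k + p) (map y [0..<k])"
  shows "Q1 \<in> carrier_mat (k + p) k"
    and "\<exists>S\<in>carrier_mat k k. Q1 = Y * S"
    and "\<exists>T\<in>carrier_mat k k. Y = Q1 * T"
proof -
  define m where "m = k + p"
  have Hc: "H \<in> carrier_mat m m" and km: "k \<le> m"
    using H unfolding nonzero_subdiag_hessenberg_def m_def by auto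
  let ?us = "rev (map (\<lambda>i. \<theta> (k + i)) [0..<p])"
  let ?ws = "map \<theta> [0..<k]"
  let ?\<psi> = "shifted_product H ?us"
  let ?Q = "accumulated_Q m Qs p"
  define P where "P = first_cols k ?\<psi>"
  note \<psi> = shifted_product_carrier[OF Hc, of ?us]
  have P: "P \<in> carrier_mat m k" unfolding P_def by (rule first_cols_carrier[OF \<psi> km])
  obtain R where R: "R \<in> carrier_mat m m" "upper_triangular R" and Q: "?Q \<in> carrier_mat m m"
    and QR: "?\<psi> = ?Q * R"
    using shifted_qr_steps_factorization[OF steps Hc order_refl] by auto
  show Q1: "Q1 \<in> carrier_mat (k + p) k"
    unfolding Q1_def using first_cols_carrier[OF Q km] unfolding m_def .
  have Y: "Y \<in> carrier_mat m k" unfolding Y_def m_def by (rule mat_of_cols_carrier_length) simp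
  define R1 where "R1 = mat k k (\<lambda>ij. R $$ ij)"
  have R1: "R1 \<in> carrier_mat k k" unfolding R1_def by simp
  have PQ: "P = Q1 * R1"
    unfolding P_def QR Q1_def R1_def using first_cols_mult_upper_triangular[OF Q R km]
    unfolding m_def .

  \<comment> \<open>Padding \<open>c\<close> with zeros turns \<open>P c\<close> into \<open>\<psi> x\<close>, whose last nonzero position is \<open>j + p < k + p\<close>.\<close>
  have Pinj: "c = 0\<^sub>v k" if c: "c \<in> carrier_vec k" "P *\<^sub>v c = 0\<^sub>v m" for c
  proof (rule ccontr)
    assume "c \<noteq> 0\<^sub>v k"
    then obtain j where j: "j < k" "last_nonzero_at c j" using last_nonzero_at_exists[OF c(1)] by auto
    define x where "x = vec m (\<lambda>i. if i < k then c $ i else 0)"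
    have x: "x \<in> carrier_vec m" unfolding x_def by simp
    have "last_nonzero_at x j"
      using j c km unfolding last_nonzero_at_def x_def by auto
    then have "last_nonzero_at (?\<psi> *\<^sub>v x) (j + p)"
      using shifted_product_last_nonzero_at[OF H, folded m_def, OF x, of j ?us] j
      unfolding m_def by simp
    moreover have "?\<psi> *\<^sub>v x = P *\<^sub>v c"
    proof (rule eq_vecI)
      fix i assume "i < dim_vec (P *\<^sub>v c)"
      then have i: "i < m" using P by simp
      have "(?\<psi> *\<^sub>v x) $ i = (\<Sum>l<m. ?\<psi> $$ (i, l) * x $ l)"
        by (rule mult_mat_vec_index[OF \<psi> x i])
      also have "\<dots> = (\<Sum>l<k. ?\<psi> $$ (i, l) * x $ l)"
        using km unfolding x_def by (intro sum.mono_neutral_right) auto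
      also have "\<dots> = (\<Sum>l<k. P $$ (i, l) * c $ l)"
        using km first_cols_index[OF \<psi> km i] unfolding x_def P_def by (intro sum.cong) auto
      also have "\<dots> = (P *\<^sub>v c) $ i"
        by (rule mult_mat_vec_index[symmetric, OF P c(1) i])
      finally show "(?\<psi> *\<^sub>v x) $ i = (P *\<^sub>v c) $ i" .
    qed (use P \<psi> in simp)
    ultimately show False using c(2) j unfolding last_nonzero_at_def m_def by simp
  qed

  \<comment> \<open>The wanted factors go to the left, so that they act on the columns of \<open>\<psi>\<close>.\<close>
  have prod_split: "(\<Prod>i<k. f i) * (\<Prod>i<q. f (k + i)) = (\<Prod>i<k + q. f i)"
    for f :: "nat \<Rightarrow> complex poly" and q
    by (induction q) (simp_all add: mult.assoc[symmetric])
  have "char_poly H = (\<Prod>e\<leftarrow>?ws @ ?us. [:- e, 1:])"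
  proof -
    have "(\<Prod>e\<leftarrow>?ws @ ?us. [:- e, 1:])
        = (\<Prod>i\<leftarrow>[0..<k]. [:- \<theta> i, 1:]) * (\<Prod>i\<leftarrow>[0..<p]. [:- \<theta> (k + i), 1:])"
      by (simp add: rev_map[symmetric] o_def prod_list.rev)
    also have "\<dots> = (\<Prod>i<k. [:- \<theta> i, 1:]) * (\<Prod>i<p. [:- \<theta> (k + i), 1:])"
      by (simp add: prod.distinct_set_conv_list[symmetric] lessThan_atLeast0)
    also have "\<dots> = (\<Prod>i<k + p. [:- \<theta> i, 1:])"
      by (rule prod_split)
    finally show ?thesis using cp by simp
  qed
  then have "shifted_product H ?ws * ?\<psi> = 0\<^sub>m m m"
    using shifted_product_char_poly_roots[OF Hc] shifted_product_append[OF Hc] by metis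
  then have ker: "shifted_product H ?ws *\<^sub>v col ?\<psi> j = 0\<^sub>v m" if "j < m" for j
    using col_mult2[OF shifted_product_carrier[OF Hc, of ?ws] \<psi> that, symmetric] that
    by (auto intro!: eq_vecI)

  have yc: "y j \<in> carrier_vec m" "y j \<noteq> 0\<^sub>v m" "shifted H (\<theta> j) *\<^sub>v y j = 0\<^sub>v m" if "j < k" for j
  proof -
    have e: "y j \<in> carrier_vec m" "y j \<noteq> 0\<^sub>v m" "H *\<^sub>v y j = \<theta> j \<cdot>\<^sub>v y j"
      using y[OF that] Hc unfolding eigenvector_def by auto
    show "y j \<in> carrier_vec m" "y j \<noteq> 0\<^sub>v m" using e by auto
    show "shifted H (\<theta> j) *\<^sub>v y j = 0\<^sub>v m"
    proof (rule eq_vecI)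
      fix i assume "i < dim_vec (0\<^sub>v m :: complex vec)"
      then have i: "i < m" by simp
      have "(\<Sum>l<m. H $$ (i, l) * y j $ l) = \<theta> j * y j $ i"
        using mult_mat_vec_index[OF Hc e(1) i] e i by simp
      then show "(shifted H (\<theta> j) *\<^sub>v y j) $ i = 0\<^sub>v m $ i"
        using shifted_mult_vec_index[OF Hc e(1) i, of "\<theta> j"] i by simp
    qed (use Hc in simp)
  qed
  have "\<exists>c. \<forall>i<m. col ?\<psi> j $ i = (\<Sum>l<k. c l * y l $ i)" if "j < k" for j
    using hessenberg_kernel_shifted_product[OF H[folded m_def] yc inj _ ker[of j]] that km \<psi> by auto
  then obtain c where c: "\<And>j i. j < k \<Longrightarrow> i < m \<Longrightarrow> col ?\<psi> j $ i = (\<Sum>l<k. c j l * y l $ i)"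
    by metis
  define C where "C = mat k k (\<lambda>(l, j). c j l)"
  have C: "C \<in> carrier_mat k k" unfolding C_def by simp
  have PY: "P = Y * C"
  proof (rule eq_matI)
    fix i j assume "i < dim_row (Y * C)" "j < dim_col (Y * C)"
    then have ij: "i < m" "j < k" using Y C by auto
    have "P $$ (i, j) = col ?\<psi> j $ i"
      unfolding P_def using first_cols_index[OF \<psi> km ij] ij km \<psi> by simp
    also have "\<dots> = (\<Sum>l<k. Y $$ (i, l) * C $$ (l, j))"
      unfolding c[OF ij(2,1)] using ij unfolding Y_def C_def m_def
      by (intro sum.cong) (auto simp: mat_of_cols_index)
    finally show "P $$ (i, j) = (Y * C) $$ (i, j)"
      using mult_mat_index[OF Y C ij] by simp
  qed (use P Y C in auto)

  obtain D where D: "D \<in> carrier_mat k k" "Q1 = P * D"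
    using injective_factor[OF Q1[folded m_def] R1 PQ Pinj] by auto
  obtain E where E: "E \<in> carrier_mat k k" "Y = P * E"
    using injective_factor[OF Y C PY Pinj] by auto
  show "\<exists>S\<in>carrier_mat k k. Q1 = Y * S"
    using D PY assoc_mult_mat[OF Y C D(1)] mult_carrier_mat[OF C D(1)] by auto
  show "\<exists>T\<in>carrier_mat k k. Y = Q1 * T"
    using E PQ assoc_mult_mat[OF Q1 R1 E(1)] mult_carrier_mat[OF R1 E(1)] by auto
qed

theorem proposition5p4:
  fixes n d k p :: nat and \<epsilon> :: real
    and A \<Omega> V H :: "real mat" and v1 r :: "real vec"
    and \<theta>s :: "nat \<Rightarrow> complex" and y u :: "nat \<Rightarrow> complex vec"
    and Hs Qs Rs :: "nat \<Rightarrow> complex mat" and Q Q1 :: "complex mat"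
  assumes "1 \<le> k"
    and "randomized_arnoldi n d (k + p) \<Omega> \<epsilon> A v1 V H r"
    and "ritz_split H k p \<theta>s"
    and "\<forall>j<k. ritz_pair V H (\<theta>s j) (y j) (u j)"
    and "shifted_qr_steps p (cmat H) (\<lambda>i. \<theta>s (k + i)) Hs Qs Rs"
    and "Q = accumulated_Q (k + p) Qs p"
    and "Q1 = first_cols k Q"
  shows "cmat V * Q1 \<in> carrier_mat n k \<and>
    colspan n (cmat V * Q1) = vspan n (u ` {..<k}) \<and>
    (\<forall>Q1' u'. Q1 = cmat Q1' \<longrightarrow> (\<forall>j<k. u j = cvec (u' j)) \<longrightarrow>
       colspan n (V * Q1') = vspan n (u' ` {..<k}))"
proof -
  define Y where "Y = mat_of_cols (k + p) (map y [0..<k])"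
  have Hc: "H \<in> carrier_mat (k + p) (k + p)" and V: "V \<in> carrier_mat n (k + p)"
    and "unreduced_hessenberg H"
    using assms(2) unfolding randomized_arnoldi_def by auto
  then have "nonzero_subdiag_hessenberg (k + p) (cmat H)"
    unfolding nonzero_subdiag_hessenberg_def unreduced_hessenberg_def by fastforce
  moreover have ev: "eigenvector (cmat H) (y j) (\<theta>s j)" and u: "u j = cmat V *\<^sub>v y j" if "j < k" for j
    using assms(4) that unfolding ritz_pair_def by auto
  ultimately have Q1: "Q1 \<in> carrier_mat (k + p) k"
    and "\<exists>S\<in>carrier_mat k k. Q1 = Y * S" and "\<exists>T\<in>carrier_mat k k. Y = Q1 * T"
    using exact_shift_factorizations[of k p "cmat H" \<theta>s y Hs Qs Rs] assms(3,5)
    unfolding assms(6,7) ritz_split_def Y_def by auto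
  then obtain S T where S: "S \<in> carrier_mat k k" "Q1 = Y * S"
    and T: "T \<in> carrier_mat k k" "Y = Q1 * T"
    by blast
  have Y: "Y \<in> carrier_mat (k + p) k" unfolding Y_def by (rule mat_of_cols_carrier_length) simp
  have cV: "cmat V \<in> carrier_mat n (k + p)" using V by simp
  define U where "U = cmat V * Y"
  have U: "U \<in> carrier_mat n k" unfolding U_def by (rule mult_carrier_mat[OF cV Y])
  have W: "cmat V * Q1 \<in> carrier_mat n k" by (rule mult_carrier_mat[OF cV Q1])
  have yc: "y j \<in> carrier_vec (k + p)" if "j < k" for j
    using ev[OF that] Hc unfolding eigenvector_def by auto
  have colU: "col U j = u j" if "j < k" for j
    unfolding U_def using col_mult2[OF cV Y that] u[OF that] that yc[OF that]
    by (simp add: Y_def)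
  have WU: "cmat V * Q1 = U * S"
    unfolding U_def using S assoc_mult_mat[OF cV Y S(1)] by simp
  have UW: "U = cmat V * Q1 * T"
    unfolding U_def using T assoc_mult_mat[OF cV Q1 T(1)] by simp
  have "colspan n (cmat V * Q1) = colspan n U"
    by (rule colspan_eqI[OF W U S(1) WU T(1) UW])
  then have main: "colspan n (cmat V * Q1) = vspan n (u ` {..<k})"
    using colspan_eq_vspan[OF U colU] by simp
  have "colspan n (V * Q1') = vspan n (u' ` {..<k})"
    if Q1': "Q1 = cmat Q1'" and u': "\<forall>j<k. u j = cvec (u' j)" for Q1' u'
  proof -
    have Q1c: "Q1' \<in> carrier_mat (k + p) k" using Q1 Q1' by auto
    note W' = mult_carrier_mat[OF V Q1c]
    have cW: "cmat V * Q1 = cmat (V * Q1')"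
      unfolding Q1' by (rule of_real_hom.mat_hom_mult[symmetric, OF V Q1c])
    define U' where "U' = mat_of_cols n (map u' [0..<k])"
    have U': "U' \<in> carrier_mat n k" unfolding U'_def by (rule mat_of_cols_carrier_length) simp
    have u'c: "u' j \<in> carrier_vec n" if "j < k" for j
      using u u' that cV by (metis dim_mult_mat_vec carrier_matD(1) carrier_vec_dim_vec index_map_vec(2))
    have colU': "col U' j = u' j" if "j < k" for j
      unfolding U'_def using u'c[OF that] that by simp
    have cU: "U = cmat U'"
    proof (rule eq_matI)
      fix i j assume "i < dim_row (cmat U')" "j < dim_col (cmat U')"
      then have ij: "i < n" "j < k" using U' by auto
      have "U $$ (i, j) = cvec (u' j) $ i"
        using colU[OF ij(2)] u' ij U by (metis carrier_matD index_col)
      also have "\<dots> = cmat U' $$ (i, j)"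
        using u'c[OF ij(2)] ij U' colU'[OF ij(2)] by (simp add: U'_def mat_of_cols_index)
      finally show "U $$ (i, j) = cmat U' $$ (i, j)" .
    qed (use U U' in auto)
    have ReS: "map_mat Re S \<in> carrier_mat k k" and ReT: "map_mat Re T \<in> carrier_mat k k"
      using S(1) T(1) by auto
    have "V * Q1' = U' * map_mat Re S"
      by (rule real_factor[OF W' U' S(1)]) (unfold cW[symmetric] cU[symmetric], rule WU)
    moreover have "U' = V * Q1' * map_mat Re T"
      by (rule real_factor[OF U' W' T(1)]) (unfold cW[symmetric] cU[symmetric], rule UW)
    ultimately have "colspan n (V * Q1') = colspan n U'"
      by (intro colspan_eqI[OF W' U' ReS _ ReT])
    then show ?thesis using colspan_eq_vspan[OF U' colU'] by simp
  qed
  with W main show ?thesis by blast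
qed

end
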